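(* Given a PTA $\mathcal A$, the problem of deciding whether there exists a parameter valuation $v$ such that $v(\mathcal A)$ contains no reachable zero-delay cycle is undecidable.
   Context: Clocks are real-valued; parameters take nonnegative rational values. Atomic constraints: $x\sim p+c$, $x\sim c$, $p\sim c$ ($\sim\in\{<,\le,=,\ge,>\}$, $c\in\mathbb Z$); constraints are conjunctions. A PTA $(\Sigma,L,\ell_0,X,P,I,E)$ has invariants $I(\ell)$ and edges $(\ell,g,a,R,\ell')$ (guard, action, reset set). For parameter valuation $v$, $v(\mathcal A)$ is the timed automaton obtained by substituting parameter values, with steps $(\ell,w)\xrightarrow{d,e}(\ell',w')$ for delay $d\ge0$ when $w+d$ satisfies the guard and $w'=(w+d)[R\mapsto0]$ (configurations satisfy invariants). A reachable zero-delay cycle is a sequence of steps, reachable from $(\ell_0,\mathbf 0)$, that follows a cycle of edges (returning to its starting location) while letting zero total time elapse. *)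

theory Defs
  imports Complex_Main "HOL-Library.Nat_Bijection"
begin

section \<open>Timed and parametric timed automata\<close>

datatype cmp = Lt | Le | Eq | Ge | Gt

fun holds :: "cmp \<Rightarrow> 'n::linorder \<Rightarrow> 'n \<Rightarrow> bool" where
  "holds Lt a b \<longleftrightarrow> a < b"
| "holds Le a b \<longleftrightarrow> a \<le> b"
| "holds Eq a b \<longleftrightarrow> a = b"
| "holds Ge a b \<longleftrightarrow> a \<ge> b"
| "holds Gt a b \<longleftrightarrow> a > b"

text \<open>An instance of a decision problem is a finite object, so locations, clocks, parameters and
  actions are named by natural numbers, and finite sets are presented by lists. A list of atoms
  is their conjunction. In an edge \<open>(l, g, a, R, l')\<close>, \<open>g\<close> is the guard and \<open>R\<close> the reset set.\<close>

type_synonym 'at edge = "nat \<times> 'at list \<times> nat \<times> nat list \<times> nat"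

record 'at automaton =
  actions :: "nat list"
  locs :: "nat list"
  init :: nat
  clocks :: "nat list"
  invar :: "nat \<Rightarrow> 'at list"
  edges :: "'at edge list"

text \<open>The atoms \<open>x \<sim> p + c\<close>, \<open>x \<sim> c\<close> and \<open>p \<sim> c\<close>.\<close>

datatype patom =
    ClockParam nat cmp nat int
  | ClockConst nat cmp int
  | ParamConst nat cmp int

text \<open>The atoms left after substituting the parameters: a clock is compared with a constant, and
  an atom \<open>p \<sim> c\<close> has become a comparison of two constants.\<close>

datatype tatom =
    TClock nat cmp rat
  | TConst rat cmp rat

type_synonym ta = "tatom automaton"

record pta = "patom automaton" +
  params :: "nat list"

fun patom_over :: "nat set \<Rightarrow> nat set \<Rightarrow> patom \<Rightarrow> bool" where
  "patom_over X P (ClockParam x r p c) \<longleftrightarrow> x \<in> X \<and> p \<in> P"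
| "patom_over X P (ClockConst x r c) \<longleftrightarrow> x \<in> X"
| "patom_over X P (ParamConst p r c) \<longleftrightarrow> p \<in> P"

definition wf_pta :: "pta \<Rightarrow> bool" where
  "wf_pta A \<longleftrightarrow>
     init A \<in> set (locs A) \<and>
     (\<forall>l \<in> set (locs A). \<forall>\<phi> \<in> set (invar A l).
        patom_over (set (clocks A)) (set (params A)) \<phi>) \<and>
     (\<forall>(l, g, a, R, l') \<in> set (edges A).
        l \<in> set (locs A) \<and> l' \<in> set (locs A) \<and> a \<in> set (actions A) \<and>
        set R \<subseteq> set (clocks A) \<and>
        (\<forall>\<phi> \<in> set g. patom_over (set (clocks A)) (set (params A)) \<phi>))"

definition parameter_valuation :: "pta \<Rightarrow> (nat \<Rightarrow> rat) \<Rightarrow> bool" where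
  "parameter_valuation A v \<longleftrightarrow> (\<forall>p \<in> set (params A). 0 \<le> v p)"

fun subst_atom :: "(nat \<Rightarrow> rat) \<Rightarrow> patom \<Rightarrow> tatom" where
  "subst_atom v (ClockParam x r p c) = TClock x r (v p + of_int c)"
| "subst_atom v (ClockConst x r c) = TClock x r (of_int c)"
| "subst_atom v (ParamConst p r c) = TConst (v p) r (of_int c)"

text \<open>The timed automaton \<open>v(A)\<close>.\<close>

definition instantiate :: "(nat \<Rightarrow> rat) \<Rightarrow> pta \<Rightarrow> ta" where
  "instantiate v A =
     \<lparr> actions = actions A, locs = locs A, init = init A, clocks = clocks A,
       invar = (\<lambda>l. map (subst_atom v) (invar A l)),
       edges = map (\<lambda>(l, g, a, R, l'). (l, map (subst_atom v) g, a, R, l')) (edges A) \<rparr>"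


section \<open>Concrete semantics\<close>

type_synonym cval = "nat \<Rightarrow> real"
type_synonym config = "nat \<times> cval"

fun sat_atom :: "cval \<Rightarrow> tatom \<Rightarrow> bool" where
  "sat_atom w (TClock x r q) \<longleftrightarrow> holds r (w x) (of_rat q)"
| "sat_atom w (TConst q r q') \<longleftrightarrow> holds r q q'"

definition sat :: "cval \<Rightarrow> tatom list \<Rightarrow> bool" where
  "sat w g \<longleftrightarrow> (\<forall>\<phi> \<in> set g. sat_atom w \<phi>)"

definition delay :: "cval \<Rightarrow> real \<Rightarrow> cval" where
  "delay w d = (\<lambda>x. w x + d)"

definition reset :: "cval \<Rightarrow> nat set \<Rightarrow> cval" where
  "reset w R = (\<lambda>x. if x \<in> R then 0 else w x)"

text \<open>A step lets time \<open>d\<close> pass and then takes the edge \<open>e\<close>; the invariant of the source holds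
  throughout the delay, its two ends included.\<close>

inductive step :: "ta \<Rightarrow> config \<Rightarrow> real \<Rightarrow> tatom edge \<Rightarrow> config \<Rightarrow> bool" for T where
  "\<lbrakk> (l, g, a, R, l') \<in> set (edges T); 0 \<le> d;
     \<forall>d'. 0 \<le> d' \<and> d' \<le> d \<longrightarrow> sat (delay w d') (invar T l);
     sat (delay w d) g;
     w' = reset (delay w d) (set R);
     sat w' (invar T l') \<rbrakk>
   \<Longrightarrow> step T (l, w) d (l, g, a, R, l') (l', w')"

inductive steps :: "ta \<Rightarrow> config \<Rightarrow> (real \<times> tatom edge) list \<Rightarrow> config \<Rightarrow> bool" for T where
  steps_Nil: "steps T s [] s"
| steps_Cons: "\<lbrakk> step T s d e s'; steps T s' \<pi> s'' \<rbrakk> \<Longrightarrow> steps T s ((d, e) # \<pi>) s''"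

definition reachable :: "ta \<Rightarrow> config \<Rightarrow> bool" where
  "reachable T s \<longleftrightarrow> sat (\<lambda>x. 0) (invar T (init T)) \<and> (\<exists>\<rho>. steps T (init T, \<lambda>x. 0) \<rho> s)"

text \<open>Only the location has to recur, not the clock valuation.\<close>

definition has_reachable_zero_delay_cycle :: "ta \<Rightarrow> bool" where
  "has_reachable_zero_delay_cycle T \<longleftrightarrow>
     (\<exists>l w w' \<pi>. reachable T (l, w) \<and> \<pi> \<noteq> [] \<and> steps T (l, w) \<pi> (l, w') \<and>
                 sum_list (map fst \<pi>) = 0)"


section \<open>Decidability\<close>

text \<open>Partial recursive functions: \<open>computes f xs y\<close> says that \<open>f\<close> is defined on \<open>xs\<close> with value
  \<open>y\<close>. The recursion variable of \<open>PrimRec\<close> and the search variable of \<open>Mu\<close> come first; \<open>Mu\<close>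
  requires its argument to be defined below the value found.\<close>

datatype recf =
    Zero
  | Succ
  | Proj nat
  | Comp recf "recf list"
  | PrimRec recf recf
  | Mu recf

inductive computes :: "recf \<Rightarrow> nat list \<Rightarrow> nat \<Rightarrow> bool" where
  computes_Zero: "computes Zero xs 0"
| computes_Succ: "computes Succ [x] (Suc x)"
| computes_Proj: "i < length xs \<Longrightarrow> computes (Proj i) xs (xs ! i)"
| computes_Comp: "\<lbrakk> list_all2 (\<lambda>g y. computes g xs y) gs ys; computes f ys z \<rbrakk>
    \<Longrightarrow> computes (Comp f gs) xs z"
| computes_PrimRec_0: "computes f xs y \<Longrightarrow> computes (PrimRec f g) (0 # xs) y"
| computes_PrimRec_Suc: "\<lbrakk> computes (PrimRec f g) (n # xs) r; computes g (n # r # xs) y \<rbrakk>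
    \<Longrightarrow> computes (PrimRec f g) (Suc n # xs) y"
| computes_Mu: "\<lbrakk> computes f (n # xs) 0; \<forall>m < n. \<exists>y. computes f (m # xs) (Suc y) \<rbrakk>
    \<Longrightarrow> computes (Mu f) xs n"

text \<open>The decision problem with instances \<open>D\<close> and question \<open>Q\<close>, where instances are given to the
  algorithm through the coding \<open>code\<close>. Nothing is asked of the algorithm on numbers that do
  not code an instance.\<close>

definition decidable_problem :: "('i \<Rightarrow> nat) \<Rightarrow> 'i set \<Rightarrow> ('i \<Rightarrow> bool) \<Rightarrow> bool" where
  "decidable_problem code D Q \<longleftrightarrow>
     (\<exists>f. \<forall>A \<in> D. computes f [code A] (if Q A then 1 else 0))"


section \<open>Coding parametric timed automata\<close>

fun cmp_code :: "cmp \<Rightarrow> nat" where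
  "cmp_code Lt = 0"
| "cmp_code Le = 1"
| "cmp_code Eq = 2"
| "cmp_code Ge = 3"
| "cmp_code Gt = 4"

fun patom_code :: "patom \<Rightarrow> nat" where
  "patom_code (ClockParam x r p c) = list_encode [0, x, cmp_code r, p, int_encode c]"
| "patom_code (ClockConst x r c) = list_encode [1, x, cmp_code r, int_encode c]"
| "patom_code (ParamConst p r c) = list_encode [2, p, cmp_code r, int_encode c]"

definition constraint_code :: "patom list \<Rightarrow> nat" where
  "constraint_code g = list_encode (map patom_code g)"

fun edge_code :: "patom edge \<Rightarrow> nat" where
  "edge_code (l, g, a, R, l') = list_encode [l, constraint_code g, a, list_encode R, l']"

text \<open>The invariant is tabulated on the locations, in the order in which these are listed.\<close>

definition pta_code :: "pta \<Rightarrow> nat" where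
  "pta_code A = list_encode
     [list_encode (actions A), list_encode (locs A), init A, list_encode (clocks A),
      list_encode (params A), list_encode (map (\<lambda>l. constraint_code (invar A l)) (locs A)),
      list_encode (map edge_code (edges A))]"

text \<open>The coding is faithful: it identifies two automata only if they have the same components,
  except for the values of \<open>invar\<close> outside the locations, which have no meaning.\<close>

lemma inj_cmp_code: "inj cmp_code"
  by (rule injI, rename_tac a b, case_tac a; case_tac b) simp_all

lemma inj_patom_code: "inj patom_code"
  by (rule injI, rename_tac a b, case_tac a; case_tac b)
     (simp_all add: list_encode_eq inj_eq[OF inj_cmp_code] int_encode_eq)

lemma inj_constraint_code: "inj constraint_code"
  by (rule injI)
     (simp add: constraint_code_def list_encode_eq inj_map_eq_map[OF inj_patom_code])

lemma inj_edge_code: "inj edge_code"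
  by (rule injI, rename_tac a b, case_tac a; case_tac b)
     (auto simp: list_encode_eq inj_eq[OF inj_constraint_code])

lemma pta_code_eqD:
  assumes "pta_code A = pta_code B"
  shows "actions A = actions B" "locs A = locs B" "init A = init B" "clocks A = clocks B"
    "params A = params B" "\<forall>l \<in> set (locs A). invar A l = invar B l" "edges A = edges B"
  using assms
  by (auto simp: pta_code_def list_encode_eq inj_map_eq_map[OF inj_edge_code]
      inj_eq[OF inj_constraint_code])

end

theory Submission imports Defs begin

text \<open>
  Suppose that \<open>f\<close> decides the problem. Let \<open>A n\<close> be the automaton with the edges coded by \<open>n\<close>,
  preceded by one edge that reads off \<open>n\<close> as a delay; its locations and clocks are \<open>n - 1, \<dots>, 0\<close>,
  which is harmless since numbers occurring in a coded object are below the code. The code of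
  \<open>A n\<close> is a recursive function of \<open>n\<close>, so a counter program can compute on input \<open>n\<close> the answer
  of \<open>f\<close> for \<open>A n\<close>, and then go to a bad location if the answer is 1 and halt if it is 0. Choosing
  for \<open>n\<close> the code of the edges that simulate this very program makes \<open>f\<close> err on \<open>A n\<close>:
  no universal machine and no recursion theorem are needed.

  In the simulation the clocks \<open>0, \<dots>, k\<close> hold, at the start of a period of length \<open>p\<close> (the
  parameter), the sums of the counters \<open>j, \<dots>, k - 1\<close>. Each clock \<open>j\<close> is reset once in the
  period, when it shows \<open>p\<close>, \<open>p - 1\<close> or \<open>p + 1\<close>, and therefore shows its old value, one more or one
  less at the end. As the sums decrease with \<open>j\<close>, the resets occur in the order \<open>0, \<dots>, k\<close>
  whatever the values are, so that a chain of \<open>k + 1\<close> edges suffices. A counter sum that is too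
  large for \<open>p\<close> leads to the bad location, which has an unguarded loop. So if the
  program reaches the bad location, every valuation has a reachable zero-delay cycle. If it halts,
  no large \<open>p\<close> has one, because each period takes positive time before the first reset.
\<close>

section \<open>Recursive functions\<close>

definition unary_recursive :: "(nat \<Rightarrow> nat) \<Rightarrow> bool" where
  "unary_recursive F \<longleftrightarrow> (\<exists>r. \<forall>x. computes r [x] (F x))"

definition binary_recursive :: "(nat \<Rightarrow> nat \<Rightarrow> nat) \<Rightarrow> bool" where
  "binary_recursive F \<longleftrightarrow> (\<exists>r. \<forall>x y. computes r [x, y] (F x y))"

lemma computes_Proj': "i < length xs \<Longrightarrow> y = xs ! i \<Longrightarrow> computes (Proj i) xs y"
  using computes_Proj by blast

lemma computes_Comp1: "computes g xs y \<Longrightarrow> computes f [y] z \<Longrightarrow> computes (Comp f [g]) xs z"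
  by (rule computes_Comp[where ys = "[y]"]) simp_all

lemma computes_Comp2:
  "computes g xs y \<Longrightarrow> computes g' xs y' \<Longrightarrow> computes f [y, y'] z \<Longrightarrow> computes (Comp f [g, g']) xs z"
  by (rule computes_Comp[where ys = "[y, y']"]) simp_all

lemma unary_recursive_id: "unary_recursive (\<lambda>x. x)"
  unfolding unary_recursive_def by (intro exI[of _ "Proj 0"] allI computes_Proj') simp_all

lemma unary_recursive_Suc: "unary_recursive F \<Longrightarrow> unary_recursive (\<lambda>x. Suc (F x))"
  unfolding unary_recursive_def by (meson computes_Comp1 computes_Succ)

lemma unary_recursive_const: "unary_recursive (\<lambda>x. c)"
proof (induction c)
  case 0
  show ?case unfolding unary_recursive_def by (meson computes_Zero)
qed (rule unary_recursive_Suc)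

lemma unary_recursive_comp2:
  assumes "binary_recursive F" "unary_recursive G" "unary_recursive H"
  shows "unary_recursive (\<lambda>x. F (G x) (H x))"
  using assms unfolding unary_recursive_def binary_recursive_def by (meson computes_Comp2)

lemma binary_recursive_comp:
  assumes "unary_recursive F" "binary_recursive G"
  shows "binary_recursive (\<lambda>x y. F (G x y))"
  using assms unfolding unary_recursive_def binary_recursive_def by (meson computes_Comp1)

lemma binary_recursive_comp2:
  assumes "binary_recursive F" "binary_recursive G" "binary_recursive H"
  shows "binary_recursive (\<lambda>x y. F (G x y) (H x y))"
  using assms unfolding binary_recursive_def by (meson computes_Comp2)

lemma binary_recursive_fst: "binary_recursive (\<lambda>x y. x)"
  unfolding binary_recursive_def by (intro exI[of _ "Proj 0"] allI computes_Proj') simp_all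

lemma binary_recursive_snd: "binary_recursive (\<lambda>x y. y)"
  unfolding binary_recursive_def by (intro exI[of _ "Proj 1"] allI computes_Proj') simp_all

lemma unary_recursive_primrec:
  assumes "binary_recursive G" "h 0 = 0" "\<And>n. h (Suc n) = G n (h n)"
  shows "unary_recursive h"
proof -
  from assms(1) obtain g where g: "\<And>x y. computes g [x, y] (G x y)"
    unfolding binary_recursive_def by blast
  have "computes (PrimRec Zero g) [n] (h n)" for n
  proof (induction n)
    case 0
    show ?case using computes_PrimRec_0[OF computes_Zero, of g "[]"] assms(2) by simp
  next
    case (Suc n)
    show ?case using computes_PrimRec_Suc[OF Suc g] assms(3) by simp
  qed
  then show ?thesis unfolding unary_recursive_def by blast
qed

lemma binary_recursive_add: "binary_recursive (+)"
proof -
  have "computes (PrimRec (Proj 0) (Comp Succ [Proj 1])) [m, n] (m + n)" for m n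
  proof (induction m)
    case 0
    show ?case by (intro computes_PrimRec_0 computes_Proj') simp_all
  next
    case (Suc m)
    have "computes (Comp Succ [Proj 1]) [m, m + n, n] (Suc (m + n))"
      by (intro computes_Comp1[OF _ computes_Succ] computes_Proj') simp_all
    with computes_PrimRec_Suc[OF Suc] show ?case by simp
  qed
  then show ?thesis unfolding binary_recursive_def by blast
qed

text \<open>\<open>prod_encode (x, y)\<close> is \<open>triangle (x + y) + x\<close>, and
  \<open>triangle\<close> obeys a primitive recursion with step \<open>r + Suc n\<close>.\<close>

lemma binary_recursive_prod_encode: "binary_recursive (\<lambda>x y. prod_encode (x, y))"
proof -
  have "binary_recursive (\<lambda>n r. r + Suc n)"
    by (intro binary_recursive_comp2[OF binary_recursive_add] binary_recursive_snd
        binary_recursive_comp[OF unary_recursive_Suc[OF unary_recursive_id]] binary_recursive_fst)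
  then have "unary_recursive triangle"
    by (rule unary_recursive_primrec) simp_all
  then show ?thesis
    unfolding prod_encode_def split
    by (intro binary_recursive_comp2[OF binary_recursive_add] binary_recursive_fst
        binary_recursive_comp[of triangle] binary_recursive_snd)
qed

lemma binary_recursive_Cons_encode: "binary_recursive (\<lambda>x y. Suc (prod_encode (x, y)))"
  by (rule binary_recursive_comp[OF unary_recursive_Suc[OF unary_recursive_id]
        binary_recursive_prod_encode])

text \<open>\<open>rev [0..<Suc n]\<close> is \<open>n # rev [0..<n]\<close>, so each code arises
  from the previous one by a single \<open>Cons\<close> step. This is why the automaton lists its
  locations and clocks in descending order.\<close>

lemma unary_recursive_list_encode_upt: "unary_recursive (\<lambda>n. list_encode (rev [0..<n]))"
  by (rule unary_recursive_primrec[OF binary_recursive_Cons_encode]) simp_all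

lemma unary_recursive_list_encode_zeros: "unary_recursive (\<lambda>n. list_encode (replicate n 0))"
proof (rule unary_recursive_primrec)
  have "binary_recursive (\<lambda>x y. (0::nat))"
    by (rule binary_recursive_comp[OF unary_recursive_const binary_recursive_fst])
  then show "binary_recursive (\<lambda>n r. Suc (prod_encode (0, r)))"
    by (rule binary_recursive_comp2[OF binary_recursive_Cons_encode _ binary_recursive_snd])
qed simp_all

section \<open>Counter programs\<close>

datatype op = Inc nat | Dec nat | Zer nat

fun reg :: "op \<Rightarrow> nat" where
  "reg (Inc r) = r"
| "reg (Dec r) = r"
| "reg (Zer r) = r"

fun enabled :: "op \<Rightarrow> (nat \<Rightarrow> nat) \<Rightarrow> bool" where
  "enabled (Inc r) s \<longleftrightarrow> True"
| "enabled (Dec r) s \<longleftrightarrow> 0 < s r"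
| "enabled (Zer r) s \<longleftrightarrow> s r = 0"

fun effect :: "op \<Rightarrow> (nat \<Rightarrow> nat) \<Rightarrow> nat \<Rightarrow> nat" where
  "effect (Inc r) s = s(r := s r + 1)"
| "effect (Dec r) s = s(r := s r - 1)"
| "effect (Zer r) s = s"

datatype com = Op op | Seq com com | Loop nat com

inductive exec :: "com \<Rightarrow> (nat \<Rightarrow> nat) \<Rightarrow> (nat \<Rightarrow> nat) \<Rightarrow> bool" where
  exec_Op: "enabled p s \<Longrightarrow> exec (Op p) s (effect p s)"
| exec_Seq: "exec c s s' \<Longrightarrow> exec c' s' s'' \<Longrightarrow> exec (Seq c c') s s''"
| exec_Loop_0: "s r = 0 \<Longrightarrow> exec (Loop r c) s s"
| exec_Loop_Suc: "0 < s r \<Longrightarrow> exec c (s(r := s r - 1)) s' \<Longrightarrow> exec (Loop r c) s' s'' \<Longrightarrow>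
    exec (Loop r c) s s''"

text \<open>For bodies that leave the loop register alone: \<open>g i\<close> describes the other
  registers after \<open>i\<close> rounds, and during a round \<open>r\<close> holds the number
  \<open>j\<close> of rounds that follow it.\<close>

lemma exec_Loop:
  assumes "\<And>i j. i + Suc j = n \<Longrightarrow> exec c ((g i)(r := j)) ((g (Suc i))(r := j))"
  shows "exec (Loop r c) ((g 0)(r := n)) ((g n)(r := 0))"
  using assms
proof (induction n arbitrary: g)
  case 0
  show ?case by (rule exec_Loop_0) simp
next
  case (Suc n)
  have 1: "exec (Loop r c) ((g (Suc 0))(r := n)) ((g (Suc n))(r := 0))"
    by (rule Suc.IH[of "\<lambda>i. g (Suc i)"], rule Suc.prems) simp
  have 2: "exec c ((g 0)(r := n)) ((g (Suc 0))(r := n))"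
    by (rule Suc.prems) simp
  show ?case
    by (rule exec_Loop_Suc[OF _ _ 1]) (use 2 in \<open>simp_all del: fun_upd_apply add: fun_upd_same\<close>)
qed

lemma exec_cong: "exec c s t \<Longrightarrow> s = s' \<Longrightarrow> t = t' \<Longrightarrow> exec c s' t'"
  by simp

lemma exec_Inc: "exec (Op (Inc r)) s (s(r := s r + 1))"
  using exec_Op[of "Inc r" s] by simp

text \<open>No single operation is enabled everywhere and changes nothing, so two that cancel are
  composed.\<close>

definition skip :: com where
  "skip = Seq (Op (Inc 0)) (Op (Dec 0))"

definition clear :: "nat \<Rightarrow> com" where
  "clear i = Loop i skip"

definition move :: "nat \<Rightarrow> nat \<Rightarrow> com" where
  "move i k = Loop i (Op (Inc k))"

text \<open>Emptying \<open>i\<close> into \<open>k\<close> destroys it; \<open>z\<close> keeps a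
  second tally from which \<open>i\<close> is restored.\<close>

definition copy :: "nat \<Rightarrow> nat \<Rightarrow> nat \<Rightarrow> com" where
  "copy i k z = Seq (Loop i (Seq (Op (Inc z)) (Op (Inc k)))) (move z i)"

lemma exec_skip: "exec skip s s"
  unfolding skip_def
  by (rule exec_Seq[OF exec_Inc], rule exec_cong[OF exec_Op]) auto

lemma exec_clear: "exec (clear i) s (s(i := 0))"
  unfolding clear_def
  by (rule exec_cong[OF exec_Loop[where n = "s i" and g = "\<lambda>_. s"]]) (auto intro: exec_skip)

lemma exec_move:
  assumes "i \<noteq> k"
  shows "exec (move i k) s (s(i := 0, k := s k + s i))"
  unfolding move_def
proof (rule exec_cong[OF exec_Loop[where n = "s i" and g = "\<lambda>j. s(k := s k + j)"]])
  fix j j'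
  show "exec (Op (Inc k)) ((s(k := s k + j))(i := j')) ((s(k := s k + Suc j))(i := j'))"
    by (rule exec_cong[OF exec_Inc refl]) (use assms in auto)
qed (use assms in auto)

lemma exec_copy:
  assumes "i \<noteq> k" "i \<noteq> z" "k \<noteq> z" "s z = 0"
  shows "exec (copy i k z) s (s(k := s k + s i))"
proof -
  have "exec (Loop i (Seq (Op (Inc z)) (Op (Inc k)))) s (s(i := 0, z := s i, k := s k + s i))"
  proof (rule exec_cong[OF exec_Loop[where n = "s i" and g = "\<lambda>j. s(z := j, k := s k + j)"]])
    fix j j'
    show "exec (Seq (Op (Inc z)) (Op (Inc k))) ((s(z := j, k := s k + j))(i := j'))
      ((s(z := Suc j, k := s k + Suc j))(i := j'))"
      by (rule exec_cong[OF exec_Seq[OF exec_Inc exec_Inc] refl]) (use assms in auto)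
  qed (use assms in auto)
  moreover have "exec (move z i) (s(i := 0, z := s i, k := s k + s i)) (s(k := s k + s i))"
    by (rule exec_cong[OF exec_move refl]) (use assms in \<open>simp_all add: fun_eq_iff\<close>)
  ultimately show ?thesis
    unfolding copy_def by (rule exec_Seq)
qed

primrec seqs :: "com list \<Rightarrow> com" where
  "seqs [] = skip"
| "seqs (c # cs) = Seq c (seqs cs)"

lemma exec_seqs_Nil: "exec (seqs []) s s"
  by (simp add: exec_skip)

lemma exec_seqs_Cons: "exec c s s' \<Longrightarrow> exec (seqs cs) s' s'' \<Longrightarrow> exec (seqs (c # cs)) s s''"
  by (simp add: exec_Seq)

text \<open>Takes the commands as functions of \<open>k\<close> and \<open>z\<close>, so that
  \<open>compile\<close> can recurse through \<open>map compile gs\<close>. The results go to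
  consecutive registers, while the scratch space stays at \<open>z\<close>.\<close>

primrec evaluate :: "(nat \<Rightarrow> nat \<Rightarrow> com) list \<Rightarrow> nat \<Rightarrow> nat \<Rightarrow> com" where
  "evaluate [] k z = skip"
| "evaluate (c # cs) k z = Seq (c k z) (evaluate cs (Suc k) z)"

text \<open>Code for a recursive function: \<open>is\<close> are the argument registers, the value is added to the
  register \<open>k\<close>, and the registers from \<open>z\<close> on are scratch space, which is zero before and after.\<close>

primrec compile :: "recf \<Rightarrow> nat list \<Rightarrow> nat \<Rightarrow> nat \<Rightarrow> com" where
  "compile Zero is k z = skip"
| "compile Succ is k z = Seq (copy (hd is) k z) (Op (Inc k))"
| "compile (Proj i) is k z = copy (is ! i) k z"
| "compile (Comp f gs) is k z =
     Seq (evaluate (map (\<lambda>c. c is) (map compile gs)) z (z + length gs))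
       (Seq (compile f [z..<z + length gs] k (z + length gs))
         (seqs (map clear [z..<z + length gs])))"
| "compile (PrimRec f g) is k z =
     seqs [copy (hd is) (z + 2) z,
       compile f (tl is) (z + 1) (z + 4),
       Loop (z + 2) (seqs
         [compile g (z # (z + 1) # tl is) (z + 3) (z + 4),
          clear (z + 1), move (z + 3) (z + 1), Op (Inc z)]),
       move (z + 1) k, clear z]"
| "compile (Mu f) is k z =
     seqs [compile f (z # is) (z + 1) (z + 2),
       Loop (z + 1) (seqs [clear (z + 1), Op (Inc z), compile f (z # is) (z + 1) (z + 2)]),
       move z k]"

text \<open>The contract of \<open>compile\<close>. Registers and states are quantified inside, so
  that subprograms can be placed anywhere; since only \<open>k\<close> changes, arguments survive
  and scratch registers return to zero.\<close>

definition adds :: "recf \<Rightarrow> nat list \<Rightarrow> nat \<Rightarrow> bool" where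
  "adds f xs y \<longleftrightarrow> (\<forall>is k z s. (\<forall>i \<in> set is. i < z) \<and> k < z \<and> k \<notin> set is \<and> (\<forall>i\<ge>z. s i = 0) \<and>
     map s is = xs \<longrightarrow> exec (compile f is k z) s (s(k := s k + y)))"

lemma addsD:
  assumes "adds f xs y" "\<forall>i \<in> set is. i < z" "k < z" "k \<notin> set is" "\<forall>i\<ge>z. s i = 0" "map s is = xs"
    "s' = s(k := s k + y)"
  shows "exec (compile f is k z) s s'"
  using assms unfolding adds_def by blast

lemma exec_evaluate:
  assumes "list_all2 (\<lambda>g y. adds g xs y) gs ys" "\<forall>i \<in> set is. i < k" "k + length gs \<le> z"
    "\<forall>i\<ge>k. s i = 0" "map s is = xs"
  shows "exec (evaluate (map (\<lambda>c. c is) (map compile gs)) k z) s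
    (\<lambda>i. if k \<le> i \<and> i < k + length gs then ys ! (i - k) else s i)"
  using assms
proof (induction gs ys arbitrary: k s rule: list_all2_induct)
  case Nil
  show ?case by (simp, rule exec_cong[OF exec_skip refl]) (simp add: fun_eq_iff)
next
  case (Cons g gs y ys)
  have 1: "exec (compile g is k z) s (s(k := y))"
    using Cons.prems by (intro addsD[OF Cons.hyps(1)]) auto
  have "map (s(k := y)) is = xs"
    using Cons.prems by auto
  then have 2: "exec (evaluate (map (\<lambda>c. c is) (map compile gs)) (Suc k) z) (s(k := y))
     (\<lambda>i. if Suc k \<le> i \<and> i < Suc k + length gs then ys ! (i - Suc k) else (s(k := y)) i)"
    using Cons.prems by (intro Cons.IH) auto
  show ?case
    by (simp, rule exec_cong[OF exec_Seq[OF 1 2[simplified]]])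
       (auto simp: fun_eq_iff nth_Cons')
qed

lemma exec_clears: "exec (seqs (map clear js)) s (\<lambda>i. if i \<in> set js then 0 else s i)"
proof (induction js arbitrary: s)
  case Nil
  show ?case by (simp add: exec_skip)
next
  case (Cons j js)
  show ?case
    by (simp, rule exec_cong[OF exec_Seq[OF exec_clear Cons]]) (auto simp: fun_eq_iff)
qed

section \<open>Correctness of the compiled programs\<close>

inductive_cases computes_ZeroE: "computes Zero xs y"
inductive_cases computes_SuccE: "computes Succ xs y"
inductive_cases computes_ProjE: "computes (Proj i) xs y"
inductive_cases computes_CompE: "computes (Comp f gs) xs y"
inductive_cases computes_PrimRec_0E: "computes (PrimRec f g) (0 # xs) y"
inductive_cases computes_PrimRec_SucE: "computes (PrimRec f g) (Suc n # xs) y"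
inductive_cases computes_PrimRecE: "computes (PrimRec f g) xs y"
inductive_cases computes_MuE: "computes (Mu f) xs y"

text \<open>Unrolls the recursion into the sequence of its intermediate values, the form that the
  loop rule \<open>exec_Loop\<close> asks for.\<close>

lemma computes_PrimRec_sequence:
  "computes (PrimRec f g) (n # xs) y \<Longrightarrow>
    \<exists>h. computes f xs (h 0) \<and> (\<forall>m<n. computes g (m # h m # xs) (h (Suc m))) \<and> y = h n"
proof (induction n arbitrary: y)
  case 0
  then show ?case by (auto elim!: computes_PrimRec_0E)
next
  case (Suc n)
  from Suc.prems obtain r where r: "computes (PrimRec f g) (n # xs) r" "computes g (n # r # xs) y"
    by (rule computes_PrimRec_SucE)
  from Suc.IH[OF r(1)] obtain h where
    h: "computes f xs (h 0)" "\<forall>m<n. computes g (m # h m # xs) (h (Suc m))" "r = h n" by blast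
  show ?case
    using h r(2) by (intro exI[of _ "h(Suc n := y)"]) (auto simp: less_Suc_eq)
qed

lemma adds_Comp:
  assumes "list_all2 (\<lambda>g y. adds g xs y) gs ys" "adds f ys y"
  shows "adds (Comp f gs) xs y"
  unfolding adds_def
proof (intro allI impI, elim conjE)
  fix "is" k z and s :: "nat \<Rightarrow> nat"
  assume h: "\<forall>i \<in> set is. i < z" "k < z" "k \<notin> set is" "\<forall>i\<ge>z. s i = 0" "map s is = xs"
  have [simp]: "length ys = length gs" using assms(1) by (simp add: list_all2_lengthD)
  let ?n = "length gs"
  let ?t = "\<lambda>i. if z \<le> i \<and> i < z + ?n then ys ! (i - z) else s i"
  have 1: "exec (evaluate (map (\<lambda>c. c is) (map compile gs)) z (z + ?n)) s ?t"
    using exec_evaluate[OF assms(1) h(1) order_refl] h by blast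
  have "map ?t [z..<z + ?n] = ys"
    by (auto intro: nth_equalityI)
  then have 2: "exec (compile f [z..<z + ?n] k (z + ?n)) ?t (?t(k := s k + y))"
    using h by (intro addsD[OF assms(2)]) auto
  show "exec (compile (Comp f gs) is k z) s (s(k := s k + y))"
    unfolding compile.simps
    using h(2,4) by (intro exec_cong[OF exec_Seq[OF 1 exec_Seq[OF 2 exec_clears]]])
       (auto simp: fun_eq_iff)
qed

text \<open>In the loop, \<open>z\<close> counts the rounds done, \<open>z + 1\<close> holds the
  current value, \<open>z + 2\<close> the rounds left, and \<open>z + 3\<close> collects the next
  value.\<close>

lemma adds_PrimRec:
  assumes "adds f xs (h 0)" "\<And>m. m < n \<Longrightarrow> adds g (m # h m # xs) (h (Suc m))"
  shows "adds (PrimRec f g) (n # xs) (h n)"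
  unfolding adds_def
proof (intro allI impI, elim conjE)
  fix is' k z and s :: "nat \<Rightarrow> nat"
  assume h: "\<forall>i \<in> set is'. i < z" "k < z" "k \<notin> set is'" "\<forall>i\<ge>z. s i = 0" "map s is' = n # xs"
  then obtain i0 "is" where is': "is' = i0 # is" by (cases is') auto
  have i0: "s i0 = n" "i0 < z" "i0 \<noteq> k" and "is": "\<forall>i \<in> set is. i < z" "k \<notin> set is" "map s is = xs"
    using h by (auto simp: is')
  have ne: "z + a \<notin> set is" for a using "is"(1) by (metis not_add_less1)
  have [simp]: "z \<notin> set is" "Suc z \<notin> set is" "Suc (Suc z) \<notin> set is"
    using ne[of 0] ne[of 1] ne[of 2] by simp_all
  let ?g = "\<lambda>m. s(z := m, z + 1 := h m)"
  let ?body = "seqs [compile g (z # (z + 1) # is) (z + 3) (z + 4),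
          clear (z + 1), move (z + 3) (z + 1), Op (Inc z)]"
  have 1: "exec (copy i0 (z + 2) z) s (s(z + 2 := n))"
    using i0 h by (intro exec_cong[OF exec_copy]) auto
  have 2: "exec (compile f is (z + 1) (z + 4)) (s(z + 2 := n)) ((?g 0)(z + 2 := n))"
    using "is" h by (intro addsD[OF assms(1)]) (auto simp: fun_eq_iff)
  have 3: "exec (Loop (z + 2) ?body) ((?g 0)(z + 2 := n)) ((?g n)(z + 2 := 0))"
  proof (rule exec_Loop)
    fix i c assume "i + Suc c = n"
    then have "i < n" by simp
    have a: "exec (compile g (z # (z + 1) # is) (z + 3) (z + 4)) ((?g i)(z + 2 := c))
       ((?g i)(z + 2 := c, z + 3 := h (Suc i)))"
      using "is" h ne by (intro addsD[OF assms(2)[OF \<open>i < n\<close>]]) (auto simp: fun_eq_iff)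
    show "exec ?body ((?g i)(z + 2 := c)) ((?g (Suc i))(z + 2 := c))"
      by (rule exec_cong[OF exec_seqs_Cons[OF a exec_seqs_Cons[OF exec_clear exec_seqs_Cons[OF
          exec_move exec_seqs_Cons[OF exec_Inc exec_seqs_Nil]]]] refl])
        (use h(4) in \<open>auto simp: fun_eq_iff\<close>)
  qed
  show "exec (compile (PrimRec f g) is' k z) s (s(k := s k + h n))"
    unfolding is' compile.simps list.sel
    by (rule exec_cong[OF exec_seqs_Cons[OF 1 exec_seqs_Cons[OF 2 exec_seqs_Cons[OF 3
          exec_seqs_Cons[OF exec_move exec_seqs_Cons[OF exec_clear exec_seqs_Nil]]]]] refl])
       (use h(2,4) in \<open>auto simp: fun_eq_iff\<close>)
qed

lemma adds_Mu:
  assumes "adds f (n # xs) 0" "\<And>m. m < n \<Longrightarrow> adds f (m # xs) (Suc (h m))"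
  shows "adds (Mu f) xs n"
  unfolding adds_def
proof (intro allI impI, elim conjE)
  fix "is" k z and s :: "nat \<Rightarrow> nat"
  assume h: "\<forall>i \<in> set is. i < z" "k < z" "k \<notin> set is" "\<forall>i\<ge>z. s i = 0" "map s is = xs"
  define v where "v m = (if m < n then Suc (h m) else 0)" for m
  have f: "adds f (m # xs) (v m)" if "m \<le> n" for m
    using assms that by (cases "m = n") (auto simp: v_def)
  have ne: "z + a \<notin> set is" for a using h(1) by (metis not_add_less1)
  have [simp]: "z \<notin> set is" "Suc z \<notin> set is" using ne[of 0] ne[of 1] by auto
  let ?s = "\<lambda>m. s(z := m, z + 1 := v m)"
  let ?loop = "Loop (z + 1) (seqs [clear (z + 1), Op (Inc z), compile f (z # is) (z + 1) (z + 2)])"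
  have ev: "exec (compile f (z # is) (z + 1) (z + 2)) (s(z := m)) (?s m)" if "m \<le> n" for m
    using h by (intro addsD[OF f[OF that]]) (auto simp: fun_eq_iff)
  \<comment> \<open>The value \<open>b\<close> is arbitrary because the loop has already decremented
    \<open>z + 1\<close>, and the body clears it first.\<close>
  have body: "exec (seqs [clear (z + 1), Op (Inc z), compile f (z # is) (z + 1) (z + 2)])
      ((?s m)(z + 1 := b)) (?s (Suc m))" if "m < n" for m b
  proof -
    have e: "exec (compile f (z # is) (z + 1) (z + 2)) (s(z := Suc m)) (?s (Suc m))"
      using that by (intro ev) simp
    have "exec (seqs [Op (Inc z), compile f (z # is) (z + 1) (z + 2)]) (s(z := m)) (?s (Suc m))"
      by (rule exec_seqs_Cons[OF exec_cong[OF exec_Inc refl] exec_seqs_Cons[OF e exec_seqs_Nil]]) simp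
    then show ?thesis
      by (intro exec_seqs_Cons[OF exec_cong[OF exec_clear refl]]) (use h(4) in \<open>auto simp: fun_eq_iff\<close>)
  qed
  \<comment> \<open>Downwards from the candidate \<open>n\<close>, whose value 0 ends the loop.
    \<open>exec_Loop\<close> does not apply, as the body rewrites the loop register.\<close>
  have loop: "exec ?loop (?s (n - m)) (s(z := n))" if "m \<le> n" for m
    using that
  proof (induction m)
    case 0
    show ?case
      by (rule exec_cong[OF exec_Loop_0 refl]) (use h(4) in \<open>auto simp: v_def fun_eq_iff\<close>)
  next
    case (Suc m)
    then have eq: "n - m = Suc (n - Suc m)" and "m \<le> n" by simp_all
    have 3: "exec ?loop (?s (Suc (n - Suc m))) (s(z := n))"
      using Suc.IH[OF \<open>m \<le> n\<close>] unfolding eq .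
    have 1: "0 < (?s (n - Suc m)) (z + 1)"
      using Suc.prems by (simp add: v_def)
    have 2: "exec (seqs [clear (z + 1), Op (Inc z), compile f (z # is) (z + 1) (z + 2)])
      ((?s (n - Suc m))(z + 1 := (?s (n - Suc m)) (z + 1) - 1)) (?s (Suc (n - Suc m)))"
      using Suc.prems by (intro body) simp
    show ?case by (rule exec_Loop_Suc[OF 1 2 3])
  qed
  have 1: "exec (compile f (z # is) (z + 1) (z + 2)) s (?s 0)"
    using ev[of 0] h(4) by (intro exec_cong[OF ev[of 0]]) (auto simp: fun_eq_iff)
  have 2: "exec ?loop (?s 0) (s(z := n))" using loop[of n] by simp
  show "exec (compile (Mu f) is k z) s (s(k := s k + n))"
    unfolding compile.simps
    by (rule exec_cong[OF exec_seqs_Cons[OF 1 exec_seqs_Cons[OF 2 exec_seqs_Cons[OF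
          exec_move exec_seqs_Nil]]] refl])
       (use h(2,4) in \<open>auto simp: fun_eq_iff\<close>)
qed

lemma adds_computes: "computes f xs y \<Longrightarrow> adds f xs y"
proof (induction f arbitrary: xs y)
  case Zero
  then show ?case by (auto simp: adds_def exec_skip elim: computes_ZeroE)
next
  case Succ
  then obtain x where xy: "xs = [x]" "y = Suc x" by (auto elim: computes_SuccE)
  show ?case
    unfolding adds_def
  proof (intro allI impI, elim conjE)
    fix "is" k z and s :: "nat \<Rightarrow> nat"
    assume h: "\<forall>i \<in> set is. i < z" "k < z" "k \<notin> set is" "\<forall>i\<ge>z. s i = 0" "map s is = xs"
    then obtain i where i: "is = [i]" "s i = x" unfolding xy by auto
    have "exec (Seq (copy i k z) (Op (Inc k))) s (s(k := s k + y))"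
      by (rule exec_cong[OF exec_Seq[OF exec_copy exec_Inc] refl])
         (use h i in \<open>simp_all add: xy\<close>)
    then show "exec (compile Succ is k z) s (s(k := s k + y))"
      by (simp add: i)
  qed
next
  case (Proj i)
  then have y: "i < length xs" "y = xs ! i" by (auto elim: computes_ProjE)
  show ?case
    unfolding adds_def
  proof (intro allI impI, elim conjE)
    fix "is" k z and s :: "nat \<Rightarrow> nat"
    assume h: "\<forall>i \<in> set is. i < z" "k < z" "k \<notin> set is" "\<forall>i\<ge>z. s i = 0" "map s is = xs"
    with y have "is ! i \<in> set is" "s (is ! i) = y" by auto
    with h show "exec (compile (Proj i) is k z) s (s(k := s k + y))"
      unfolding compile.simps by (intro exec_cong[OF exec_copy refl]) auto
  qed
next
  case (Comp f gs)
  from Comp.prems obtain ys where "list_all2 (\<lambda>g y. computes g xs y) gs ys" "computes f ys y"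
    by (rule computes_CompE)
  with Comp.IH show ?case
    by (intro adds_Comp[of xs gs ys]) (auto simp: list_all2_conv_all_nth)
next
  case (PrimRec f g)
  from PrimRec.prems obtain n xs' where xs: "xs = n # xs'" by (rule computes_PrimRecE) auto
  from computes_PrimRec_sequence[OF PrimRec.prems[unfolded xs]] obtain h where
    "computes f xs' (h 0)" "\<forall>m<n. computes g (m # h m # xs') (h (Suc m))" "y = h n" by blast
  with PrimRec.IH show ?case unfolding xs by (blast intro: adds_PrimRec)
next
  case (Mu f)
  from Mu.prems have 0: "computes f (y # xs) 0" and 1: "\<forall>m<y. \<exists>z. computes f (m # xs) (Suc z)"
    by (auto elim: computes_MuE)
  from 1 obtain h where "\<forall>m<y. computes f (m # xs) (Suc (h m))" by metis
  with 0 Mu.IH show ?case by (blast intro: adds_Mu)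
qed

section \<open>Flow graphs\<close>

type_synonym transition = "nat \<times> op \<times> nat"

text \<open>Counts the nodes of the flow graph other than its exit.\<close>

primrec size_com :: "com \<Rightarrow> nat" where
  "size_com (Op p) = 1"
| "size_com (Seq c c') = size_com c + size_com c'"
| "size_com (Loop r c) = Suc (size_com c)"

text \<open>Flow graph of a command, entered at \<open>l\<close> and left at \<open>e\<close>; its other nodes follow \<open>l\<close>.\<close>

primrec flow :: "com \<Rightarrow> nat \<Rightarrow> nat \<Rightarrow> transition list" where
  "flow (Op p) l e = [(l, p, e)]"
| "flow (Seq c c') l e = flow c l (l + size_com c) @ flow c' (l + size_com c) e"
| "flow (Loop r c) l e = (l, Dec r, Suc l) # (l, Zer r, e) # flow c (Suc l) l"

inductive mstep :: "transition list \<Rightarrow> nat \<times> (nat \<Rightarrow> nat) \<Rightarrow> nat \<times> (nat \<Rightarrow> nat) \<Rightarrow> bool"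
  for T where
  "(l, p, l') \<in> set T \<Longrightarrow> enabled p s \<Longrightarrow> mstep T (l, s) (l', effect p s)"

lemma exec_flow:
  "exec c s s' \<Longrightarrow> set (flow c l e) \<subseteq> set T \<Longrightarrow> (mstep T)\<^sup>*\<^sup>* (l, s) (e, s')"
proof (induction arbitrary: l e rule: exec.induct)
  case (exec_Op p s)
  then show ?case by (auto intro: mstep.intros)
next
  case (exec_Seq c s s' c' s'')
  then show ?case by (metis Un_subset_iff flow.simps(2) rtranclp_trans set_append)
next
  case (exec_Loop_0 s r c)
  then have "mstep T (l, s) (e, effect (Zer r) s)" by (intro mstep.intros) auto
  then show ?case by auto
next
  case (exec_Loop_Suc s r c s' s'')
  then have "mstep T (l, s) (Suc l, effect (Dec r) s)" by (intro mstep.intros) auto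
  moreover have "(mstep T)\<^sup>*\<^sup>* (Suc l, effect (Dec r) s) (l, s')"
    unfolding effect.simps using exec_Loop_Suc.prems by (intro exec_Loop_Suc.IH(1)) auto
  moreover have "(mstep T)\<^sup>*\<^sup>* (l, s') (e, s'')"
    using exec_Loop_Suc.IH(2) exec_Loop_Suc.prems by auto
  ultimately show ?case by (meson converse_rtranclp_into_rtranclp rtranclp_trans)
qed

lemma flow_source: "(l', p, e') \<in> set (flow c l e) \<Longrightarrow> l \<le> l' \<and> l' < l + size_com c"
  by (induction c arbitrary: l e) fastforce+

section \<open>Determinism of the flow graphs\<close>

definition deterministic :: "transition list \<Rightarrow> bool" where
  "deterministic T \<longleftrightarrow> (\<forall>l p e p' e' s. (l, p, e) \<in> set T \<longrightarrow> (l, p', e') \<in> set T \<longrightarrow>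
     enabled p s \<longrightarrow> enabled p' s \<longrightarrow> p = p' \<and> e = e')"

lemma deterministic_append:
  assumes "deterministic T" "deterministic T'"
    "\<And>l p e p' e'. (l, p, e) \<in> set T \<Longrightarrow> (l, p', e') \<in> set T' \<Longrightarrow> False"
  shows "deterministic (T @ T')"
  using assms unfolding deterministic_def set_append Un_iff by meson

text \<open>By \<open>flow_source\<close>, different subcommands have disjoint source nodes. The
  only nodes with two edges are loop heads, where \<open>Dec r\<close> and \<open>Zer r\<close>
  exclude each other.\<close>

lemma deterministic_flow: "deterministic (flow c l e)"
proof (induction c arbitrary: l e)
  case (Op p)
  show ?case by (simp add: deterministic_def)
next
  case (Seq c c')
  then show ?case
    by (auto intro!: deterministic_append dest!: flow_source)
next
  case (Loop r c)
  have "deterministic [(l, Dec r, Suc l), (l, Zer r, e)]"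
    by (auto simp: deterministic_def)
  then have "deterministic ([(l, Dec r, Suc l), (l, Zer r, e)] @ flow c (Suc l) l)"
    using Loop by (intro deterministic_append) (auto dest: flow_source)
  then show ?case by simp
qed

lemma right_unique_mstep: "deterministic T \<Longrightarrow> right_unique (mstep T)"
  unfolding deterministic_def by (intro right_uniqueI) (auto elim!: mstep.cases, blast+)

text \<open>By right-uniqueness everything reachable from \<open>a\<close> lies on the one path to
  the stuck state \<open>b\<close>. This bounds the counters of a halting run and keeps it away from
  the bad node.\<close>

lemma terminating_run:
  assumes "R\<^sup>*\<^sup>* a b" "right_unique R" "\<forall>y. \<not> R b y"
  shows "finite {x. R\<^sup>*\<^sup>* a x}" "R\<^sup>*\<^sup>* a x \<Longrightarrow> R\<^sup>*\<^sup>* x b"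
proof -
  have "finite {x. R\<^sup>*\<^sup>* a x} \<and> (\<forall>x. R\<^sup>*\<^sup>* a x \<longrightarrow> R\<^sup>*\<^sup>* x b)"
    using assms(1)
  proof (induction rule: converse_rtranclp_induct)
    case base
    have "{x. R\<^sup>*\<^sup>* b x} = {b}"
      using assms(3) by (auto elim: converse_rtranclpE)
    then show ?case by auto
  next
    case (step a a')
    have "{x. R\<^sup>*\<^sup>* a x} \<subseteq> insert a {x. R\<^sup>*\<^sup>* a' x}"
      using right_uniqueD[OF assms(2) step.hyps(1)] by (auto elim: converse_rtranclpE)
    then show ?case
      using step by (auto intro: finite_subset converse_rtranclp_into_rtranclp)
  qed
  then show "finite {x. R\<^sup>*\<^sup>* a x}" "R\<^sup>*\<^sup>* a x \<Longrightarrow> R\<^sup>*\<^sup>* x b" by blast+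
qed

section \<open>The simulating automaton\<close>

text \<open>\<open>Main m\<close> is node \<open>m\<close> of the flow graph, the bad node being 0; \<open>Chain p m j\<close> lies within
  the period that performs \<open>p\<close> on the way to node \<open>m\<close>, and clock \<open>j\<close> is the next one to be reset.\<close>

datatype loc = Init | Loaded | Main nat | Chain op nat nat

fun loc_code :: "loc \<Rightarrow> nat" where
  "loc_code Init = list_encode []"
| "loc_code Loaded = list_encode [0]"
| "loc_code (Main m) = list_encode [0, m]"
| "loc_code (Chain (Inc r) m j) = list_encode [0, r, m, j]"
| "loc_code (Chain (Dec r) m j) = list_encode [1, r, m, j]"
| "loc_code (Chain (Zer r) m j) = list_encode [2, r, m, j]"

lemma loc_code_eq_iff [simp]: "loc_code L = loc_code L' \<longleftrightarrow> L = L'"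
  by (cases L rule: loc_code.cases; cases L' rule: loc_code.cases)
     (simp_all add: list_encode_eq del: list_encode.simps)

text \<open>Clock \<open>j\<close> is reset when it shows the parameter plus this shift, and so ends
  the period with its old value minus the shift. Counter \<open>r\<close> is a summand of exactly
  the sums with \<open>j \<le> r\<close>.\<close>

fun shift :: "op \<Rightarrow> nat \<Rightarrow> int" where
  "shift (Inc r) j = (if j \<le> r then - 1 else 0)"
| "shift (Dec r) j = (if j \<le> r then 1 else 0)"
| "shift (Zer r) j = 0"

text \<open>Inner locations record the target of the transition but not its source, so transitions
  with the same operation and target share a chain.\<close>

fun chain_loc :: "nat \<Rightarrow> transition \<Rightarrow> nat \<Rightarrow> loc" where
  "chain_loc k (m, p, m') j =
     (if j = 0 then Main m else if j = Suc k then Main m' else Chain p m' j)"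

text \<open>Counter \<open>j\<close> is zero iff the sums in the clocks \<open>j\<close> and \<open>j + 1\<close> agree. A decrement of a zero
  counter needs no test: it would have to reset clock \<open>j\<close> after the time due for clock \<open>j + 1\<close>.\<close>

definition chain_guard :: "op \<Rightarrow> nat \<Rightarrow> patom list" where
  "chain_guard p j = ClockParam j Eq 0 (shift p j) #
     (if p = Zer j then [ClockParam (Suc j) Eq 0 0] else [])"

definition chain_edge :: "nat \<Rightarrow> transition \<Rightarrow> nat \<Rightarrow> patom edge" where
  "chain_edge k t j = (loc_code (chain_loc k t j), chain_guard (fst (snd t)) j, 0, [j],
     loc_code (chain_loc k t (Suc j)))"

text \<open>The test of clock \<open>k\<close>, which is zero at the start of a period, forbids any delay.\<close>

definition overflow_edge :: "nat \<Rightarrow> transition \<Rightarrow> patom edge" where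
  "overflow_edge k t = (loc_code (Main (fst t)),
     [ClockConst k Eq 0, ClockParam 0 Ge 0 (shift (fst (snd t)) 0)], 0, [], loc_code (Main 0))"

text \<open>The input is counter 0, so clock 0 keeps \<open>n\<close> and the others start at 0;
  testing clock 1, which \<open>input_edge\<close> has reset, forbids a delay. None of these edges
  mentions \<open>n\<close>, which is what allows \<open>n\<close> to be their code.\<close>

definition program_edges :: "nat \<Rightarrow> transition list \<Rightarrow> patom edge list" where
  "program_edges k T =
     (loc_code Loaded, [ClockConst 1 Eq 0], 0, [1..<Suc k], loc_code (Main 1)) #
     (loc_code (Main 0), [], 0, [], loc_code (Main 0)) #
     concat (map (\<lambda>t. overflow_edge k t # map (chain_edge k t) [0..<Suc k]) T)"

definition input_edge :: "nat \<Rightarrow> patom edge" where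
  "input_edge n = (loc_code Init, [ClockConst 0 Eq (int n)], 0, [1], loc_code Loaded)"

definition input_pta :: "nat \<Rightarrow> patom edge list \<Rightarrow> pta" where
  "input_pta n es = \<lparr> actions = [0], locs = rev [0..<n], init = loc_code Init,
     clocks = rev [0..<n], invar = (\<lambda>_. []), edges = input_edge n # es, params = [0] \<rparr>"

lemma step_instantiate:
  assumes "invar A = (\<lambda>_. [])"
  shows "step (instantiate v A) (l, w) d e (l', w') \<longleftrightarrow>
    (\<exists>g a R. (l, g, a, R, l') \<in> set (edges A) \<and> e = (l, map (subst_atom v) g, a, R, l') \<and> 0 \<le> d \<and>
       sat (delay w d) (map (subst_atom v) g) \<and> w' = reset (delay w d) (set R))"
  by (auto simp: step.simps instantiate_def assms sat_def image_iff Bex_def split: prod.splits)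

lemma steps_snoc: "steps T s \<pi> s' \<Longrightarrow> step T s' d e s'' \<Longrightarrow> steps T s (\<pi> @ [(d, e)]) s''"
  by (induction rule: steps.induct) (auto intro: steps.intros)

lemma reachable_step: "reachable T s \<Longrightarrow> step T s d e s' \<Longrightarrow> reachable T s'"
  unfolding reachable_def by (blast intro: steps_snoc)

lemma reachable_edge:
  assumes "invar A = (\<lambda>_. [])" "reachable (instantiate v A) (l, w)" "(l, g, a, R, l') \<in> set (edges A)"
    "0 \<le> d" "sat (delay w d) (map (subst_atom v) g)"
  shows "reachable (instantiate v A) (l', reset (delay w d) (set R))"
  using reachable_step[OF assms(2)] step_instantiate[OF assms(1)] assms(3-5) by blast

section \<open>Counter sums and the timetable of a period\<close>

definition tail_sum :: "nat \<Rightarrow> (nat \<Rightarrow> nat) \<Rightarrow> nat \<Rightarrow> nat" where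
  "tail_sum k c j = (\<Sum>i = j..<k. c i)"

text \<open>The value due in clock \<open>j\<close> at the end of the period; it is -1 when a
  decrement meets an empty sum.\<close>

definition target :: "nat \<Rightarrow> op \<Rightarrow> (nat \<Rightarrow> nat) \<Rightarrow> nat \<Rightarrow> real" where
  "target k p c j = real (tail_sum k c j) - of_int (shift p j)"

lemma tail_sum_rec: "j < k \<Longrightarrow> tail_sum k c j = c j + tail_sum k c (Suc j)"
  unfolding tail_sum_def by (simp add: sum.atLeast_Suc_lessThan)

lemma tail_sum_self [simp]: "tail_sum k c k = 0"
  by (simp add: tail_sum_def)

lemma tail_sum_mono: "tail_sum k c (Suc j) \<le> tail_sum k c j"
  unfolding tail_sum_def by (rule sum_mono2) auto

lemma tail_sum_update:
  assumes "r < k"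
  shows "tail_sum k (c(r := x)) j + (if j \<le> r then c r else 0) =
    tail_sum k c j + (if j \<le> r then x else 0)"
proof (cases "j \<le> r")
  case True
  with assms have "r \<in> {j..<k}" by simp
  then show ?thesis
    unfolding tail_sum_def using True by (simp add: sum.remove[of "{j..<k}" r])
next
  case False
  then show ?thesis unfolding tail_sum_def by (auto intro!: sum.cong)
qed

lemma target_effect:
  assumes "enabled p c" "reg p < k"
  shows "target k p c j = tail_sum k (effect p c) j"
proof (cases p)
  case (Inc r)
  with tail_sum_update[of r k c "Suc (c r)" j] assms show ?thesis
    by (auto simp: target_def split: if_splits)
next
  case (Dec r)
  with tail_sum_update[of r k c "c r - 1" j] assms show ?thesis
    by (auto simp: target_def split: if_splits)
next
  case (Zer r)
  then show ?thesis by (simp add: target_def)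
qed

text \<open>The time within the period at which the run of the chain arrives at position \<open>j\<close>.\<close>

definition chain_time :: "nat \<Rightarrow> real \<Rightarrow> op \<Rightarrow> (nat \<Rightarrow> nat) \<Rightarrow> nat \<Rightarrow> real" where
  "chain_time k P p c j = (if j = 0 then 0 else P - target k p c (j - 1))"

text \<open>A clock reset in this period was reset at time \<open>P - target k p c i\<close>; any
  other clock has grown from its sum since time 0.\<close>

definition in_chain :: "nat \<Rightarrow> real \<Rightarrow> op \<Rightarrow> (nat \<Rightarrow> nat) \<Rightarrow> nat \<Rightarrow> cval \<Rightarrow> bool" where
  "in_chain k P p c j w \<longleftrightarrow> (\<forall>i\<le>k. w i = chain_time k P p c j +
     (if i < j then target k p c i - P else real (tail_sum k c i)))"

definition in_main :: "nat \<Rightarrow> (nat \<Rightarrow> nat) \<Rightarrow> cval \<Rightarrow> bool" where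
  "in_main k c w \<longleftrightarrow> (\<forall>i\<le>k. w i = real (tail_sum k c i))"

lemma in_chain_0: "in_chain k P p c 0 w \<longleftrightarrow> in_main k c w"
  by (simp add: in_chain_def in_main_def chain_time_def)

lemma in_chain_Suc_self:
  assumes "in_chain k P p c (Suc k) w" "enabled p c" "reg p < k"
  shows "in_main k (effect p c) w"
  using assms(1) unfolding in_chain_def in_main_def
  by (simp add: chain_time_def target_effect[OF assms(2,3)])

text \<open>The equality test of clock \<open>j\<close> leaves one possible delay. For
  \<open>Zer j\<close>, neither clock \<open>j\<close> nor clock \<open>Suc j\<close> has been reset
  yet, so both show \<open>P\<close> together iff their sums agree.\<close>

lemma sat_chain_guard:
  assumes "in_chain k P p c j w" "P = of_rat (v 0)" "j \<le> k" "reg p < k"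
  shows "sat (delay w d) (map (subst_atom v) (chain_guard p j)) \<longleftrightarrow>
    d = chain_time k P p c (Suc j) - chain_time k P p c j \<and>
    (p = Zer j \<longrightarrow> tail_sum k c j = tail_sum k c (Suc j))"
proof -
  have 1: "w j = chain_time k P p c j + tail_sum k c j"
    using assms unfolding in_chain_def by simp
  have 2: "w (Suc j) = chain_time k P p c j + tail_sum k c (Suc j)" if "p = Zer j"
    using assms that unfolding in_chain_def by simp
  show ?thesis
    using 1 2 unfolding sat_def chain_guard_def
    by (auto simp: delay_def assms(2) of_rat_add chain_time_def target_def)
qed

lemma in_chain_Suc:
  assumes "in_chain k P p c j w" "d = chain_time k P p c (Suc j) - chain_time k P p c j"
  shows "in_chain k P p c (Suc j) (reset (delay w d) {j})"
  using assms unfolding in_chain_def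
  by (auto simp: reset_def delay_def less_Suc_eq chain_time_def)

lemma set_program_edges:
  "e \<in> set (program_edges k T) \<longleftrightarrow>
     e = (loc_code Loaded, [ClockConst 1 Eq 0], 0, [1..<Suc k], loc_code (Main 1)) \<or>
     e = (loc_code (Main 0), [], 0, [], loc_code (Main 0)) \<or>
     (\<exists>t \<in> set T. e = overflow_edge k t \<or> (\<exists>j\<le>k. e = chain_edge k t j))"
proof -
  have "set [0..<Suc k] = {..k}" by auto
  then show ?thesis
    unfolding program_edges_def
    by (auto simp: image_iff simp del: upt_Suc set_upt loc_code.simps)
qed

lemma invar_input_pta [simp]: "invar (input_pta n es) = (\<lambda>_. [])"
  and edges_input_pta [simp]: "edges (input_pta n es) = input_edge n # es"
  and init_input_pta [simp]: "init (input_pta n es) = loc_code Init"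
  by (simp_all add: input_pta_def)

section \<open>Runs of the automaton\<close>

lemma bad_zero_delay_cycle:
  assumes "reachable (instantiate v (input_pta n (program_edges k T))) (loc_code (Main 0), w)"
  shows "has_reachable_zero_delay_cycle (instantiate v (input_pta n (program_edges k T)))"
proof -
  let ?e = "(loc_code (Main 0), [], 0, [], loc_code (Main 0))"
  have "step (instantiate v (input_pta n (program_edges k T))) (loc_code (Main 0), w) 0 ?e
      (loc_code (Main 0), w)"
    by (auto simp: step_instantiate set_program_edges sat_def reset_def delay_def
        simp del: loc_code.simps)
  then show ?thesis
    unfolding has_reachable_zero_delay_cycle_def
    using assms by (intro exI[of _ "loc_code (Main 0)"] exI[of _ w] exI[of _ "[(0, ?e)]"])
      (auto intro: steps.intros simp del: loc_code.simps)
qed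

lemma chain_step:
  assumes "reachable (instantiate v (input_pta n (program_edges k T))) (loc_code (chain_loc k t j), w)"
    "in_chain k P p c j w" "t \<in> set T" "fst (snd t) = p" "P = of_rat (v 0)" "j \<le> k" "reg p < k"
    "chain_time k P p c j \<le> chain_time k P p c (Suc j)"
    "p = Zer j \<Longrightarrow> tail_sum k c j = tail_sum k c (Suc j)"
  shows "\<exists>w'. reachable (instantiate v (input_pta n (program_edges k T)))
      (loc_code (chain_loc k t (Suc j)), w') \<and> in_chain k P p c (Suc j) w'"
proof (intro exI conjI)
  let ?d = "chain_time k P p c (Suc j) - chain_time k P p c j"
  show "in_chain k P p c (Suc j) (reset (delay w ?d) (set [j]))"
    using in_chain_Suc[OF assms(2) refl] by simp
  have "chain_edge k t j \<in> set (edges (input_pta n (program_edges k T)))"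
    using assms(3,6) by (auto simp: set_program_edges simp del: loc_code.simps)
  then have "(loc_code (chain_loc k t j), chain_guard p j, 0, [j], loc_code (chain_loc k t (Suc j)))
      \<in> set (edges (input_pta n (program_edges k T)))"
    by (simp only: chain_edge_def assms(4))
  then show "reachable (instantiate v (input_pta n (program_edges k T)))
      (loc_code (chain_loc k t (Suc j)), reset (delay w ?d) (set [j]))"
    using assms(8,9) sat_chain_guard[where v = v, OF assms(2,5,6,7)]
    by (intro reachable_edge[OF _ assms(1)]) auto
qed

lemma simulate_mstep:
  assumes "reachable (instantiate v (input_pta n (program_edges k T))) (loc_code (Main m), w)"
    "in_main k c w" "mstep T (m, c) (m', c')" "\<forall>(l, p, l') \<in> set T. reg p < k"
  shows "has_reachable_zero_delay_cycle (instantiate v (input_pta n (program_edges k T))) \<or>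
    (\<exists>w'. reachable (instantiate v (input_pta n (program_edges k T))) (loc_code (Main m'), w') \<and>
      in_main k c' w')"
proof -
  from assms(3) obtain p where p: "(m, p, m') \<in> set T" "enabled p c" "c' = effect p c"
    by (auto elim: mstep.cases)
  then have r: "reg p < k" using assms(4) by auto
  define P :: real where "P = of_rat (v 0)"
  show ?thesis
  proof (cases "P \<ge> target k p c 0")
    case False
    \<comment> \<open>The first reset would be due before the period begins, which is a case of
      overflow.\<close>
    have "(loc_code (Main m), [ClockConst k Eq 0, ClockParam 0 Ge 0 (shift p 0)], 0, [],
        loc_code (Main 0)) \<in> set (edges (input_pta n (program_edges k T)))"
      using p(1) by (force simp: set_program_edges overflow_edge_def simp del: loc_code.simps)
    then have "reachable (instantiate v (input_pta n (program_edges k T)))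
        (loc_code (Main 0), reset (delay w 0) (set []))"
      using False assms(2)
      by (intro reachable_edge[OF _ assms(1)])
         (auto simp: sat_def delay_def in_main_def P_def target_def of_rat_add)
    then show ?thesis using bad_zero_delay_cycle by blast
  next
    case True
    \<comment> \<open>As \<open>p\<close> is enabled, the targets are the sums of the next state.
      They decrease with \<open>j\<close>, so the resets fall due in the order of the chain.\<close>
    have le: "chain_time k P p c j \<le> chain_time k P p c (Suc j)" if "j \<le> k" for j
      using True tail_sum_mono[of k "effect p c" "j - 1"]
      by (auto simp: chain_time_def target_effect[OF p(2) r])
    have "\<exists>w'. reachable (instantiate v (input_pta n (program_edges k T)))
        (loc_code (chain_loc k (m, p, m') j), w') \<and> in_chain k P p c j w'" if "j \<le> Suc k" for j
      using that
    proof (induction j)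
      case 0
      then show ?case using assms(1,2) by (auto simp: in_chain_0)
    next
      case (Suc j)
      then obtain w' where "reachable (instantiate v (input_pta n (program_edges k T)))
        (loc_code (chain_loc k (m, p, m') j), w')" "in_chain k P p c j w'" by auto
      then show ?case
        using Suc.prems p r le P_def by (intro chain_step) (auto simp: tail_sum_rec)
    qed
    from this[of "Suc k"] show ?thesis
      using in_chain_Suc_self[OF _ p(2) r] p(3) by auto
  qed
qed

lemma simulate_run:
  assumes "(mstep T)\<^sup>*\<^sup>* (1, (\<lambda>_. 0)(0 := n)) (0, c)" "\<forall>(l, p, l') \<in> set T. reg p < k" "1 \<le> k"
  shows "has_reachable_zero_delay_cycle (instantiate v (input_pta n (program_edges k T)))"
proof (rule ccontr)
  assume no: "\<not> ?thesis"
  let ?A = "input_pta n (program_edges k T)"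
  have "reachable (instantiate v ?A) (loc_code Init, \<lambda>_. 0)"
    unfolding reachable_def by (auto simp: instantiate_def sat_def intro: steps_Nil)
  then have "reachable (instantiate v ?A) (loc_code Loaded, reset (delay (\<lambda>_. 0) n) (set [1]))"
    by (rule reachable_edge[rotated]) (auto simp: input_edge_def sat_def delay_def)
  then have "reachable (instantiate v ?A) (loc_code (Main 1),
      reset (delay (reset (delay (\<lambda>_. 0) n) (set [1])) 0) (set [1..<Suc k]))"
    by (rule reachable_edge[rotated, where g = "[ClockConst 1 Eq 0]"])
      (auto simp: set_program_edges sat_def delay_def reset_def simp del: loc_code.simps upt_Suc)
  moreover have "in_main k ((\<lambda>_. 0)(0 := n))
      (reset (delay (reset (delay (\<lambda>_. 0) n) (set [1])) 0) (set [1..<Suc k]))"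
    using \<open>1 \<le> k\<close> unfolding in_main_def tail_sum_def reset_def delay_def
    by (auto simp: sum.atLeast_Suc_lessThan simp del: upt_Suc)
  ultimately have start: "\<exists>w. reachable (instantiate v ?A) (loc_code (Main 1), w) \<and>
      in_main k ((\<lambda>_. 0)(0 := n)) w" by blast
  have "\<exists>w. reachable (instantiate v ?A) (loc_code (Main m), w) \<and> in_main k c w"
    if "(mstep T)\<^sup>*\<^sup>* (1, (\<lambda>_. 0)(0 := n)) (m, c)" for m c
    using that
  proof (induction rule: rtranclp_induct2)
    case refl
    show ?case by (rule start)
  next
    case (step m c m' c')
    then show ?case using simulate_mstep[OF _ _ step.hyps(2) assms(2)] no by blast
  qed
  from this[OF assms(1)] show False
    using bad_zero_delay_cycle no by blast
qed

section \<open>A halting run excludes zero-delay cycles for a large parameter\<close>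

text \<open>Zero-delay steps between reachable configurations strictly increase this rank, provided that
  the parameter is large.\<close>

fun rank :: "nat \<Rightarrow> loc \<Rightarrow> nat" where
  "rank k Init = 0"
| "rank k Loaded = 1"
| "rank k (Chain p m j) = 2 + j"
| "rank k (Main m) = 3 + k"

text \<open>What the guards of the first \<open>j\<close> edges of the chain have checked: the times at which the
  clocks are reset do not decrease, and a zero test has succeeded.\<close>

definition passed :: "nat \<Rightarrow> op \<Rightarrow> (nat \<Rightarrow> nat) \<Rightarrow> nat \<Rightarrow> bool" where
  "passed k p c j \<longleftrightarrow> (\<forall>i. Suc i < j \<longrightarrow> target k p c (Suc i) \<le> target k p c i) \<and>
     (\<forall>r<j. p = Zer r \<longrightarrow> tail_sum k c r = tail_sum k c (Suc r))"

text \<open>For \<open>Dec r\<close> the shift stops at clock \<open>r\<close>: the order of the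
  resets of \<open>r\<close> and \<open>Suc r\<close> says that sum \<open>Suc r\<close> is at most
  sum \<open>r\<close> minus 1, so counter \<open>r\<close> is positive.\<close>

lemma passed_enabled:
  assumes "passed k p c (Suc k)" "reg p < k"
  shows "enabled p c"
proof (cases p)
  case (Dec r)
  with assms have "r < k" "target k p c (Suc r) \<le> target k p c r"
    by (auto simp: passed_def)
  then show ?thesis using Dec by (simp add: target_def tail_sum_rec)
next
  case (Zer r)
  with assms have "r < k" "tail_sum k c r = tail_sum k c (Suc r)"
    by (auto simp: passed_def)
  then show ?thesis using Zer by (simp add: tail_sum_rec)
qed simp

text \<open>An invariant of all reachable configurations. Inside a chain, \<open>c\<close> is the
  state at the start of the period, and \<open>m\<close> is quantified since the location does not
  determine it.\<close>

fun good :: "nat \<Rightarrow> transition list \<Rightarrow> real \<Rightarrow> nat \<Rightarrow> loc \<Rightarrow> cval \<Rightarrow> bool" where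
  "good k T P n Init w \<longleftrightarrow> w = (\<lambda>_. 0)"
| "good k T P n Loaded w \<longleftrightarrow> w 0 = n \<and> w 1 = 0"
| "good k T P n (Main m) w \<longleftrightarrow>
     (\<exists>c. (mstep T)\<^sup>*\<^sup>* (1, (\<lambda>_. 0)(0 := n)) (m, c) \<and> in_main k c w)"
| "good k T P n (Chain p m' j) w \<longleftrightarrow>
     (\<exists>m c. (mstep T)\<^sup>*\<^sup>* (1, (\<lambda>_. 0)(0 := n)) (m, c) \<and> (m, p, m') \<in> set T \<and>
       1 \<le> j \<and> j \<le> k \<and> in_chain k P p c j w \<and> passed k p c j)"

lemma good_step:
  assumes "good k T P n L w"
    "step (instantiate v (input_pta n (program_edges k T))) (loc_code L, w) d e (l', w')"
    "\<forall>(l, p, l') \<in> set T. reg p < k" "1 \<le> k" "P = of_rat (v 0)"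
    "\<forall>m c. (mstep T)\<^sup>*\<^sup>* (1, (\<lambda>_. 0)(0 := n)) (m, c) \<longrightarrow> m \<noteq> 0 \<and> real (tail_sum k c 0) + 1 < P"
  shows "\<exists>L'. l' = loc_code L' \<and> good k T P n L' w' \<and> (d = 0 \<longrightarrow> rank k L < rank k L')"
proof -
  from assms(2) obtain g a R where
    e: "(loc_code L, g, a, R, l') \<in> set (input_edge n # program_edges k T)"
    and d: "0 \<le> d" and g: "sat (delay w d) (map (subst_atom v) g)"
    and w': "w' = reset (delay w d) (set R)"
    by (auto simp: step_instantiate)
  from e consider
      (input) "(loc_code L, g, a, R, l') = input_edge n"
    | (start) "(loc_code L, g, a, R, l') =
        (loc_code Loaded, [ClockConst 1 Eq 0], 0, [1..<Suc k], loc_code (Main 1))"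
    | (bad) "(loc_code L, g, a, R, l') = (loc_code (Main 0), [], 0, [], loc_code (Main 0))"
    | (overflow) t where "t \<in> set T" "(loc_code L, g, a, R, l') = overflow_edge k t"
    | (chain) t j where "t \<in> set T" "j \<le> k" "(loc_code L, g, a, R, l') = chain_edge k t j"
    by (auto simp only: set_program_edges list.set(2) insert_iff)
  then show ?thesis
  proof cases
    case input
    then have "L = Init" "l' = loc_code Loaded" "g = [ClockConst 0 Eq (int n)]" "R = [1]"
      by (simp_all add: input_edge_def del: loc_code.simps)
    with assms(1) g w' show ?thesis
      by (intro exI[of _ Loaded])
         (auto simp: sat_def delay_def reset_def simp del: loc_code.simps)
  next
    case start
    then have "L = Loaded" "l' = loc_code (Main 1)" "g = [ClockConst 1 Eq 0]" "R = [1..<Suc k]"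
      by (simp_all del: loc_code.simps upt_Suc)
    with assms(1) g w' \<open>1 \<le> k\<close> have "in_main k ((\<lambda>_. 0)(0 := n)) w'"
      unfolding in_main_def tail_sum_def
      by (auto simp: sat_def delay_def reset_def sum.atLeast_Suc_lessThan Suc_le_eq simp del: upt_Suc)
    with \<open>L = Loaded\<close> \<open>l' = loc_code (Main 1)\<close> show ?thesis
      by (intro exI[of _ "Main 1"]) auto
  next
    case bad
    then have "L = Main 0" by (simp del: loc_code.simps)
    with assms(1,6) show ?thesis by fastforce
  next
    case overflow
    obtain m p m' where t: "t = (m, p, m')" by (cases t) auto
    from overflow have L: "L = Main m" and geq: "g = [ClockConst k Eq 0, ClockParam 0 Ge 0 (shift p 0)]"
      by (simp_all add: overflow_edge_def t del: loc_code.simps)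
    from assms(1) obtain c where
      c: "(mstep T)\<^sup>*\<^sup>* (1, (\<lambda>_. 0)(0 := n)) (m, c)" "in_main k c w" by (auto simp: L)
    from c(2) have "w k = 0" "w 0 = tail_sum k c 0" by (simp_all add: in_main_def)
    with g have "real (tail_sum k c 0) \<ge> P + of_int (shift p 0)"
      by (simp add: geq sat_def delay_def assms(5) of_rat_add)
    \<comment> \<open>The slack \<open>+ 1\<close> in the bound on \<open>P\<close> covers a shift
      of -1, so the overflow guard fails.\<close>
    moreover have "shift p 0 \<ge> - 1" by (cases p) auto
    ultimately show ?thesis using assms(6)[rule_format, OF c(1)] by linarith
  next
    case chain
    obtain m0 p m' where t: "t = (m0, p, m')" by (cases t) auto
    from chain have L: "L = chain_loc k (m0, p, m') j"
      and eqs: "g = chain_guard p j" "R = [j]" "l' = loc_code (chain_loc k (m0, p, m') (Suc j))"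
      by (simp_all add: chain_edge_def t del: loc_code.simps chain_loc.simps)
    have "\<exists>m c. (mstep T)\<^sup>*\<^sup>* (1, (\<lambda>_. 0)(0 := n)) (m, c) \<and> (m, p, m') \<in> set T \<and>
        in_chain k P p c j w \<and> passed k p c j"
    proof (cases "j = 0")
      case True
      with assms(1) chain(1) show ?thesis
        by (auto simp: L t in_chain_0 passed_def)
    next
      case False
      with assms(1) chain(2) show ?thesis by (auto simp: L)
    qed
    then obtain m c where c: "(mstep T)\<^sup>*\<^sup>* (1, (\<lambda>_. 0)(0 := n)) (m, c)" "(m, p, m') \<in> set T"
      "in_chain k P p c j w" "passed k p c j" by blast
    then have r: "reg p < k" using assms(3) by auto
    from sat_chain_guard[where v = v, OF c(3) assms(5) chain(2) r] g eqs(1)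
    have deq: "d = chain_time k P p c (Suc j) - chain_time k P p c j"
      and z: "p = Zer j \<longrightarrow> tail_sum k c j = tail_sum k c (Suc j)" by simp_all
    have 1: "in_chain k P p c (Suc j) w'"
      using in_chain_Suc[OF c(3) deq] by (simp add: w' eqs(2))
    \<comment> \<open>\<open>0 \<le> d\<close> says that this reset is no earlier than the previous
      one.\<close>
    have 2: "passed k p c (Suc j)"
      using c(4) z d unfolding passed_def deq
      by (auto simp: less_Suc_eq chain_time_def)
    \<comment> \<open>Only the edges with \<open>j = 0\<close>, from a main location into a chain,
      lower the rank; there the delay is positive.\<close>
    have "real (tail_sum k c 0) + 1 < P" using assms(6)[rule_format, OF c(1)] by simp
    moreover have "shift p 0 \<ge> - 1" by (cases p) auto
    ultimately have 3: "0 < d" if "j = 0"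
      using that by (simp add: deq chain_time_def target_def)
    have "good k T P n (chain_loc k (m0, p, m') (Suc j)) w'"
    proof (cases "j = k")
      case True
      have en: "enabled p c" using passed_enabled[OF _ r] 2 True by simp
      have "(mstep T)\<^sup>*\<^sup>* (1, (\<lambda>_. 0)(0 := n)) (m', effect p c)"
        using c(1) mstep.intros[OF c(2) en] by (rule rtranclp.rtrancl_into_rtrancl)
      moreover have "in_main k (effect p c) w'"
        using in_chain_Suc_self[OF _ en r] 1 True by simp
      ultimately show ?thesis using True by auto
    next
      case False
      with 1 2 c(1,2) chain(2) show ?thesis by auto
    qed
    moreover have "rank k L < rank k (chain_loc k (m0, p, m') (Suc j))" if "d = 0"
      using that 3 chain(2) by (auto simp: L)
    ultimately show ?thesis using eqs(3) by blast
  qed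
qed

text \<open>Delays are nonnegative, so a zero total makes each of them zero and the rank rises at
  every step.\<close>

lemma good_steps:
  assumes "steps (instantiate v (input_pta n (program_edges k T))) s \<pi> s'"
    "s = (loc_code L, w)" "good k T P n L w"
    "\<forall>(l, p, l') \<in> set T. reg p < k" "1 \<le> k" "P = of_rat (v 0)"
    "\<forall>m c. (mstep T)\<^sup>*\<^sup>* (1, (\<lambda>_. 0)(0 := n)) (m, c) \<longrightarrow> m \<noteq> 0 \<and> real (tail_sum k c 0) + 1 < P"
  shows "0 \<le> sum_list (map fst \<pi>) \<and> (\<exists>L' w'. s' = (loc_code L', w') \<and> good k T P n L' w' \<and>
    (sum_list (map fst \<pi>) = 0 \<longrightarrow> \<pi> \<noteq> [] \<longrightarrow> rank k L < rank k L'))"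
  using assms(1-3)
proof (induction arbitrary: L w rule: steps.induct)
  case (steps_Nil s)
  then show ?case by auto
next
  case (steps_Cons s d e s' \<pi> s'')
  obtain l1 w1 where s': "s' = (l1, w1)" by fastforce
  have d: "0 \<le> d" using steps_Cons.hyps(1) by (auto elim: step.cases)
  have "step (instantiate v (input_pta n (program_edges k T))) (loc_code L, w) d e (l1, w1)"
    using steps_Cons.hyps(1) unfolding s' steps_Cons.prems(1) .
  from good_step[OF steps_Cons.prems(2) this assms(4-7)]
  obtain L1 where L1: "l1 = loc_code L1" "good k T P n L1 w1" "d = 0 \<longrightarrow> rank k L < rank k L1"
    by blast
  from steps_Cons.IH[OF s'[unfolded L1(1)] L1(2)] obtain L' w' where
    IH: "0 \<le> sum_list (map fst \<pi>)" "s'' = (loc_code L', w')" "good k T P n L' w'"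
      "sum_list (map fst \<pi>) = 0 \<longrightarrow> \<pi> \<noteq> [] \<longrightarrow> rank k L1 < rank k L'" by blast
  have "rank k L < rank k L'" if "d + sum_list (map fst \<pi>) = 0"
  proof -
    from that d IH(1) have "d = 0" "sum_list (map fst \<pi>) = 0" by linarith+
    then have "rank k L < rank k L1" "\<pi> \<noteq> [] \<longrightarrow> rank k L1 < rank k L'" using L1(3) IH(4) by auto
    moreover have "L' = L1" if "\<pi> = []"
      using steps_Cons.hyps(2) that IH(2) s' L1(1) by (auto elim: steps.cases)
    ultimately show ?thesis by (cases "\<pi> = []") auto
  qed
  with d IH show ?case by auto
qed

lemma no_zero_delay_cycle:
  assumes "\<forall>(l, p, l') \<in> set T. reg p < k" "1 \<le> k"
    "\<forall>m c. (mstep T)\<^sup>*\<^sup>* (1, (\<lambda>_. 0)(0 := n)) (m, c) \<longrightarrow>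
      m \<noteq> 0 \<and> real (tail_sum k c 0) + 1 < of_rat (v 0)"
  shows "\<not> has_reachable_zero_delay_cycle (instantiate v (input_pta n (program_edges k T)))"
proof
  let ?A = "instantiate v (input_pta n (program_edges k T))"
  assume "has_reachable_zero_delay_cycle ?A"
  then obtain l w w' \<pi> \<rho> where r: "steps ?A (loc_code Init, \<lambda>x. 0) \<rho> (l, w)"
    and c: "\<pi> \<noteq> []" "steps ?A (l, w) \<pi> (l, w')" "sum_list (map fst \<pi>) = 0"
    unfolding has_reachable_zero_delay_cycle_def reachable_def
    by (auto simp: instantiate_def simp del: loc_code.simps)
  have "good k T (of_rat (v 0)) n Init (\<lambda>x. 0)" by simp
  from good_steps[OF r refl this assms(1,2) refl assms(3)]
  obtain L where L: "l = loc_code L" "good k T (of_rat (v 0)) n L w" by blast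
  from good_steps[OF c(2)[unfolded L(1)] refl L(2) assms(1,2) refl assms(3)] c(1,3)
  show False by (auto simp del: loc_code.simps)
qed

section \<open>The code of the automaton\<close>

lemma list_encode_gt: "x \<in> set xs \<Longrightarrow> x < list_encode xs"
proof (induction xs)
  case (Cons y ys)
  then show ?case
    using le_prod_encode_1[of y "list_encode ys"] le_prod_encode_2[of "list_encode ys" y] by auto
qed simp

lemma patom_over_split: "patom_over X P \<phi> \<longleftrightarrow> patom_over X UNIV \<phi> \<and> patom_over UNIV P \<phi>"
  by (cases \<phi>) auto

lemma patom_over_code:
  assumes "patom_code \<phi> < n"
  shows "patom_over {..<n} UNIV \<phi>"
proof -
  have lt: "x < n" if "x \<in> set xs" "list_encode xs < n" for x xs
    using list_encode_gt[OF that(1)] that(2) by simp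
  show ?thesis
  proof (cases \<phi>)
    case (ClockParam x r p c)
    with assms lt[of x "[0, x, cmp_code r, p, int_encode c]"] show ?thesis
      by (simp del: list_encode.simps)
  next
    case (ClockConst x r c)
    with assms lt[of x "[1, x, cmp_code r, int_encode c]"] show ?thesis
      by (simp del: list_encode.simps)
  qed simp
qed

lemma edge_over_code:
  assumes "(l, g, a, R, l') \<in> set es" "n = list_encode (map edge_code es)"
  shows "l < n" "l' < n" "set R \<subseteq> {..<n}" "\<forall>\<phi> \<in> set g. patom_over {..<n} UNIV \<phi>"
proof -
  have "edge_code (l, g, a, R, l') \<in> set (map edge_code es)"
    using assms(1) by (metis imageI list.set_map)
  then have lt: "edge_code (l, g, a, R, l') < n"
    unfolding assms(2) by (rule list_encode_gt)
  have m: "x < n" if "x \<in> set [l, constraint_code g, a, list_encode R, l']" for x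
    using list_encode_gt[OF that] lt by (simp del: list_encode.simps)
  show "l < n" "l' < n" by (simp_all add: m)
  have "list_encode R < n" "constraint_code g < n" by (simp_all add: m)
  then show "set R \<subseteq> {..<n}" by (auto dest: list_encode_gt)
  show "\<forall>\<phi> \<in> set g. patom_over {..<n} UNIV \<phi>"
  proof
    fix \<phi> assume "\<phi> \<in> set g"
    then have "patom_code \<phi> < constraint_code g"
      unfolding constraint_code_def by (intro list_encode_gt) simp
    with \<open>constraint_code g < n\<close> show "patom_over {..<n} UNIV \<phi>"
      by (intro patom_over_code) simp
  qed
qed

lemma wf_input_pta:
  assumes "n = list_encode (map edge_code (program_edges k T))"
  shows "wf_pta (input_pta n (program_edges k T))"
proof -
  let ?e = "(loc_code Loaded, [ClockConst 1 Eq 0], 0, [1..<Suc k], loc_code (Main 1))"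
  have *: "l < n \<and> l' < n \<and> a = 0 \<and> (\<forall>x \<in> set R. x < n) \<and> (\<forall>\<phi> \<in> set g. patom_over {..<n} {0} \<phi>)"
    if "(l, g, a, R, l') \<in> set (program_edges k T)" for l g a R l'
  proof -
    have "\<forall>\<phi> \<in> set g. patom_over UNIV {0} \<phi>" "a = 0"
      using that by (auto simp: set_program_edges overflow_edge_def chain_edge_def chain_guard_def
          split: if_splits simp del: loc_code.simps chain_loc.simps)
    then show ?thesis
      using edge_over_code[OF that assms] patom_over_split[of "{..<n}" "{0}"] by blast
  qed
  \<comment> \<open>The names in \<open>input_edge\<close>, which \<open>n\<close> does not code,
    are bounded through this edge: it mentions \<open>Loaded\<close> and clock 1.\<close>
  have "?e \<in> set (program_edges k T)" by (simp add: set_program_edges del: loc_code.simps)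
  from *[OF this] have i: "loc_code Loaded < n" "1 < n" by simp_all
  have "loc_code Init < n" using i by simp
  moreover have "set (rev [0..<n]) = {..<n}" by auto
  ultimately show ?thesis
    using * i unfolding wf_pta_def input_pta_def input_edge_def
    by (auto simp del: set_rev set_upt loc_code.simps)
qed

section \<open>The code of the automaton as a recursive function of \<open>n\<close>\<close>

text \<open>The code of \<open>input_pta n es\<close> when \<open>n\<close> is itself the code of \<open>es\<close>.\<close>

definition self_code :: "nat \<Rightarrow> nat" where
  "self_code n = list_encode
     [list_encode [0], list_encode (rev [0..<n]), loc_code Init, list_encode (rev [0..<n]),
      list_encode [0], list_encode (replicate n 0),
      Suc (prod_encode (list_encode
        [loc_code Init, list_encode [list_encode [1, 0, 2, n + n]], 0, list_encode [1],
         loc_code Loaded], n))]"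

text \<open>As \<open>n\<close> codes \<open>es\<close>, prepending the input edge pairs its code
  with \<open>n\<close>, and nothing else depends on \<open>es\<close>. Here \<open>n + n\<close> is
  \<open>int_encode (int n)\<close>, and the zeros code the empty invariants.\<close>

lemma pta_code_input_pta:
  assumes "n = list_encode (map edge_code es)"
  shows "pta_code (input_pta n es) = self_code n"
proof -
  have "edge_code (input_edge n) = list_encode
        [loc_code Init, list_encode [list_encode [1, 0, 2, n + n]], 0, list_encode [1],
         loc_code Loaded]"
    by (simp add: input_edge_def constraint_code_def int_encode_def sum_encode_def mult_2
        del: loc_code.simps list_encode.simps)
  moreover have "map (\<lambda>l. constraint_code []) (rev [0..<n]) = replicate n 0"
    by (simp add: constraint_code_def map_replicate_const)
  ultimately show ?thesis
    unfolding pta_code_def self_code_def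
    by (simp add: input_pta_def assms[symmetric] del: loc_code.simps)
qed

lemma unary_recursive_list_encode_Nil: "unary_recursive (\<lambda>x. list_encode [])"
  by (rule unary_recursive_const)

lemma unary_recursive_list_encode_Cons:
  "unary_recursive F \<Longrightarrow> unary_recursive (\<lambda>x. list_encode (G x)) \<Longrightarrow>
    unary_recursive (\<lambda>x. list_encode (F x # G x))"
  by (simp add: unary_recursive_comp2[OF binary_recursive_Cons_encode])

lemma unary_recursive_self_code: "unary_recursive self_code"
  unfolding self_code_def
  by (intro unary_recursive_list_encode_Nil unary_recursive_list_encode_Cons
      unary_recursive_const unary_recursive_id unary_recursive_comp2[OF binary_recursive_add]
      unary_recursive_list_encode_upt unary_recursive_list_encode_zeros
      unary_recursive_comp2[OF binary_recursive_Cons_encode])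

section \<open>Undecidability\<close>

theorem theorem3p9:
  "\<not> decidable_problem pta_code {A. wf_pta A}
       (\<lambda>A. \<exists>v. parameter_valuation A v \<and>
                 \<not> has_reachable_zero_delay_cycle (instantiate v A))"
proof
  let ?Q = "\<lambda>A. \<exists>v. parameter_valuation A v \<and> \<not> has_reachable_zero_delay_cycle (instantiate v A)"
  assume "decidable_problem pta_code {A. wf_pta A} ?Q"
  then obtain f where f: "\<And>A. wf_pta A \<Longrightarrow> computes f [pta_code A] (if ?Q A then 1 else 0)"
    unfolding decidable_problem_def by blast
  obtain r where r: "\<And>n. computes r [n] (self_code n)"
    using unary_recursive_self_code unfolding unary_recursive_def by blast
  \<comment> \<open>Register 0 holds the input, register 1 receives the answer, and scratch space
    starts at 2.\<close>
  define c where "c = compile (Comp f [r]) [0] 1 2"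
  define e where "e = Suc (size_com c)"
  \<comment> \<open>The code starts at node 1, as 0 is the bad node. The exit \<open>e\<close>
    offers only \<open>Dec 1\<close>, which leads to the bad node on answer 1 and blocks on answer
    0.\<close>
  define T where "T = flow c 1 e @ [(e, Dec 1, 0)]"
  have "finite ((\<lambda>(l, p, l'). reg p) ` set T)" by simp
  then obtain b where "\<forall>i \<in> (\<lambda>(l, p, l'). reg p) ` set T. i < b"
    unfolding finite_nat_set_iff_bounded by blast
  then have reg: "\<forall>(l, p, l') \<in> set T. reg p < Suc b"
    by (auto simp: less_Suc_eq)
  define es where "es = program_edges (Suc b) T"
  \<comment> \<open>The diagonal step: \<open>T\<close> does not depend on \<open>n\<close>, so
    \<open>n\<close> may code the very edges that simulate \<open>T\<close>.\<close>
  define n where "n = list_encode (map edge_code es)"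
  define A where "A = input_pta n es"
  define y :: nat where "y = (if ?Q A then 1 else 0)"
  let ?s = "(\<lambda>_. 0)(0 := n)"
  have wf: "wf_pta A" unfolding A_def es_def by (rule wf_input_pta) (simp add: n_def es_def)
  have code: "pta_code A = self_code n"
    unfolding A_def by (rule pta_code_input_pta) (rule n_def)
  have "computes (Comp f [r]) [n] y"
    using computes_Comp1[OF r f[OF wf, unfolded code]] unfolding y_def .
  then have "exec c ?s (?s(1 := y))"
    unfolding c_def by (intro addsD[OF adds_computes]) auto
  then have run: "(mstep T)\<^sup>*\<^sup>* (1, ?s) (e, ?s(1 := y))"
    by (rule exec_flow) (auto simp: T_def)
  show False
  proof (cases "?Q A")
    case True
    then have "mstep T (e, ?s(1 := y)) (0, effect (Dec 1) (?s(1 := y)))"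
      by (intro mstep.intros) (auto simp: T_def y_def)
    with run have "(mstep T)\<^sup>*\<^sup>* (1, ?s) (0, effect (Dec 1) (?s(1 := y)))"
      by (rule rtranclp.rtrancl_into_rtrancl)
    then have "has_reachable_zero_delay_cycle (instantiate v A)" for v
      unfolding A_def es_def by (rule simulate_run[OF _ reg]) simp
    with True show False by blast
  next
    case False
    have src: "1 \<le> l \<and> (l = e \<longrightarrow> p = Dec 1)" if "(l, p, l') \<in> set T" for l p l'
      using that by (auto simp: T_def e_def dest: flow_source)
    have det: "deterministic T"
      unfolding T_def
    proof (rule deterministic_append[OF deterministic_flow])
      show "deterministic [(e, Dec 1, 0)]" by (simp add: deterministic_def)
    qed (auto simp: e_def dest: flow_source)
    have stuck: "\<forall>x. \<not> mstep T (e, ?s(1 := y)) x"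
    proof (intro allI notI)
      fix x assume "mstep T (e, ?s(1 := y)) x"
      then obtain p l' where "(e, p, l') \<in> set T" "enabled p (?s(1 := y))"
        by (rule mstep.cases) auto
      with src have "enabled (Dec 1) (?s(1 := y))" by blast
      moreover have "y = 0" unfolding y_def using False by (rule if_not_P)
      ultimately show False by simp
    qed
    note halt = terminating_run[OF run right_unique_mstep[OF det] stuck]
    obtain B where B: "\<forall>i \<in> (\<lambda>(m, c). tail_sum (Suc b) c 0) ` {x. (mstep T)\<^sup>*\<^sup>* (1, ?s) x}. i < B"
      using finite_imageI[OF halt(1), of "\<lambda>(m, c). tail_sum (Suc b) c 0"]
      unfolding finite_nat_set_iff_bounded by blast
    \<comment> \<open>All sums along the run are below \<open>B\<close>, so \<open>Suc B\<close>
      exceeds each of them by more than 1.\<close>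
    define v :: "nat \<Rightarrow> rat" where "v = (\<lambda>_. of_nat (Suc B))"
    have "m \<noteq> 0 \<and> real (tail_sum (Suc b) c 0) + 1 < of_rat (v 0)"
      if reach: "(mstep T)\<^sup>*\<^sup>* (1, ?s) (m, c)" for m c
    proof
      \<comment> \<open>The bad node has no outgoing transition, whereas every reachable state leads
        on to node \<open>e\<close>.\<close>
      have "\<not> mstep T (0, c) x" for x
        using src by (force elim!: mstep.cases)
      then have "\<not> (mstep T)\<^sup>*\<^sup>* (0, c) (e, ?s(1 := y))"
        by (auto simp: e_def elim: converse_rtranclpE)
      with halt(2)[OF reach] show "m \<noteq> 0" by metis
      have "tail_sum (Suc b) c 0 < B" using B reach by force
      then show "real (tail_sum (Suc b) c 0) + 1 < of_rat (v 0)"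
        by (simp add: v_def of_rat_add)
    qed
    then have "\<not> has_reachable_zero_delay_cycle (instantiate v A)"
      unfolding A_def es_def by (intro no_zero_delay_cycle[OF reg]) auto
    moreover have "parameter_valuation A v" by (simp add: parameter_valuation_def v_def)
    ultimately show False using False by blast
  qed
qed

end
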